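(* Let $a>0$ be a real number and let $(R_n)_{n\geq 1}$ be the sequence of polynomials defined by $R_1(x)=x$ and, for $n\geq 1$, $R_{n+1}(x)=xR_n(x)-\frac{a}{n}(1-x^2)R_n'(x)$. Then for every $n\geq 1$, $R_n$ admits $n$ real roots, which are mutually distinct and lie in $(-1,1)$. Moreover, for every $n\geq 1$, the zeros of $R_n$ and the zeros of $R_{n+1}$ interlace.
   Context: The real zeros of two polynomials $P$ and $Q$ (each with simple real zeros) are said to interlace if $P$ and $Q$ have no common real zero and strictly between any two consecutive real zeros of either polynomial there is exactly one real zero of the other. When $P$ has $n$ real zeros $\alpha_1<\dots<\alpha_n$ and $Q$ has $n+1$ real zeros $\beta_1<\dots<\beta_{n+1}$, this means $\beta_1<\alpha_1<\beta_2<\alpha_2<\dots<\alpha_n<\beta_{n+1}$. *)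

theory Defs
  imports "HOL-Computational_Algebra.Polynomial"
begin

definition consecutive_zeros :: "real poly \<Rightarrow> real \<Rightarrow> real \<Rightarrow> bool" where
  "consecutive_zeros P x y \<longleftrightarrow>
     x < y \<and> poly P x = 0 \<and> poly P y = 0 \<and> (\<forall>z. x < z \<and> z < y \<longrightarrow> poly P z \<noteq> 0)"

(* For a real polynomial, rsquarefree says that it is nonzero and that all its
   real zeros are simple; non-real zeros are not restricted. *)
definition interlace :: "real poly \<Rightarrow> real poly \<Rightarrow> bool" where
  "interlace P Q \<longleftrightarrow>
     rsquarefree P \<and> rsquarefree Q \<and>
     (\<forall>x. \<not> (poly P x = 0 \<and> poly Q x = 0)) \<and>
     (\<forall>x y. consecutive_zeros P x y \<longrightarrow> (\<exists>!z. x < z \<and> z < y \<and> poly Q z = 0)) \<and>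
     (\<forall>x y. consecutive_zeros Q x y \<longrightarrow> (\<exists>!z. x < z \<and> z < y \<and> poly P z = 0))"

end

theory Submission
  imports Defs
begin

text \<open>
  At a zero \<open>x\<close> of \<open>R\<^sub>n\<close> the recurrence gives \<open>R\<^sub>n\<^sub>+\<^sub>1(x) = -(a/n)(1 - x\<^sup>2) R\<^sub>n'(x)\<close>,
  whose sign is opposite to that of \<open>R\<^sub>n'(x)\<close>; moreover \<open>R\<^sub>n(1) = 1\<close> and \<open>R\<^sub>n(-1) = (-1)\<^sup>n\<close>.
  Since the derivative of \<open>R\<^sub>n\<close> alternates in sign along its simple zeros, \<open>R\<^sub>n\<^sub>+\<^sub>1\<close> changes sign
  on each of the \<open>n + 1\<close> intervals into which the zeros of \<open>R\<^sub>n\<close> cut \<open>(-1,1)\<close>.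
  As its degree is at most \<open>n + 1\<close>, it has exactly one simple zero in each of them and no others.
\<close>

section \<open>Simple roots from a root count\<close>

text \<open>A double root \<open>a\<close> of \<open>p\<close> remains a root of the cofactor
  \<open>q\<close> of \<open>[:-a, 1:]\<close>, so all real roots of \<open>p\<close> are roots of
  \<open>q\<close>, which has smaller degree and hence too few of them.\<close>

lemma rsquarefree_of_card_roots:
  fixes p :: "real poly"
  assumes "p \<noteq> 0" and card: "degree p \<le> card {x. poly p x = 0}"
  shows "rsquarefree p"
  unfolding rsquarefree_roots
proof (intro allI notI)
  fix a assume a: "poly p a = 0 \<and> poly (pderiv p) a = 0"
  then obtain q where q: "p = [:-a, 1:] * q"
    using poly_eq_0_iff_dvd by (metis dvdE)
  have "poly q a = 0"
    using a unfolding q by (simp only: pderiv_mult poly_add poly_mult) (simp add: pderiv_pCons)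
  then have sub: "{x. poly p x = 0} \<subseteq> {x. poly q x = 0}"
    by (auto simp: q)
  have "q \<noteq> 0" using assms(1) q by auto
  then have "card {x. poly p x = 0} \<le> card {x. poly q x = 0}"
    by (intro card_mono sub poly_roots_finite)
  also have "\<dots> \<le> degree q"
    using \<open>q \<noteq> 0\<close> by (rule card_poly_roots_bound)
  also have "\<dots> < degree p"
    using \<open>q \<noteq> 0\<close> unfolding q by (subst degree_mult_eq) auto
  finally show False using card by simp
qed

section \<open>Signs of a polynomial between and beside its zeros\<close>

lemma poly_same_sign:
  fixes p :: "real poly"
  assumes "x \<le> y" and "\<And>z. x \<le> z \<Longrightarrow> z \<le> y \<Longrightarrow> poly p z \<noteq> 0"
  shows "poly p x * poly p y > 0"
proof (rule ccontr)
  assume *: "\<not> poly p x * poly p y > 0"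
  have nz: "poly p x \<noteq> 0" "poly p y \<noteq> 0" using assms by auto
  with * have neg: "poly p x * poly p y < 0"
    by (metis linorder_neqE_linordered_idom mult_eq_0_iff)
  then have "x < y" using assms(1) by (cases "x = y") (auto simp: not_less mult_less_0_iff)
  from poly_IVT[OF this neg] assms(2) show False by force
qed

text \<open>Scaling \<open>p\<close> by its derivative at \<open>x\<close> makes the new derivative
  there a square, hence positive. The scaled polynomial is then positive just to the right of
  \<open>x\<close>, and it keeps this sign up to \<open>w\<close>.\<close>

lemma sign_right_of_zero:
  fixes p :: "real poly"
  assumes "poly p x = 0" "poly (pderiv p) x \<noteq> 0" "x < w"
    and nz: "\<And>z. x < z \<Longrightarrow> z \<le> w \<Longrightarrow> poly p z \<noteq> 0"
  shows "poly (pderiv p) x * poly p w > 0"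
proof -
  define q where "q = smult (poly (pderiv p) x) p"
  have "DERIV (poly q) x :> poly (pderiv q) x" by (rule poly_DERIV)
  moreover have "poly (pderiv q) x > 0"
    using assms(2) by (auto simp: q_def pderiv_smult zero_less_mult_iff)
  ultimately obtain d where d: "d > 0" "\<And>h. h > 0 \<Longrightarrow> h < d \<Longrightarrow> poly q x < poly q (x + h)"
    using DERIV_pos_inc_right by blast
  define h where "h = min (d / 2) (w - x)"
  have h: "h > 0" "h < d" "x + h \<le> w" using d(1) assms(3) by (auto simp: h_def)
  have "0 < poly q (x + h)" using d(2)[OF h(1,2)] assms(1) by (simp add: q_def)
  moreover have "poly q (x + h) * poly q w > 0"
    using h assms(2) nz by (intro poly_same_sign) (auto simp: q_def)
  ultimately have "poly q w > 0" by (rule zero_less_mult_pos[rotated])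
  then show ?thesis by (simp add: q_def)
qed

text \<open>Reflection in the origin reduces this to the right-hand case; it negates the derivative,
  which reverses the inequality.\<close>

lemma sign_left_of_zero:
  fixes p :: "real poly"
  assumes "poly p x = 0" "poly (pderiv p) x \<noteq> 0" "w < x"
    and "\<And>z. w \<le> z \<Longrightarrow> z < x \<Longrightarrow> poly p z \<noteq> 0"
  shows "poly (pderiv p) x * poly p w < 0"
proof -
  have "poly (pderiv (pcompose p [:0, -1:])) (- x) * poly (pcompose p [:0, -1:]) (- w) > 0"
    using assms by (intro sign_right_of_zero) (auto simp: poly_pcompose pderiv_pcompose pderiv_pCons)
  then show ?thesis by (simp add: poly_pcompose pderiv_pcompose pderiv_pCons)
qed

section \<open>Zeros in gaps and interlacing\<close>

text \<open>Applied to the zeros of \<open>P\<close> together with both interval endpoints, so that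
  the outer gaps are treated like the inner ones.\<close>

definition adjacent_in :: "'a::linorder set \<Rightarrow> 'a \<Rightarrow> 'a \<Rightarrow> bool" where
  "adjacent_in T x y \<longleftrightarrow> x \<in> T \<and> y \<in> T \<and> x < y \<and> (\<forall>z. x < z \<and> z < y \<longrightarrow> z \<notin> T)"

text \<open>There are \<open>card S + 1\<close> gaps, as many as the degree of \<open>Q\<close>
  allows zeros. One zero per gap therefore exhausts the zeros of \<open>Q\<close>, and their order
  relative to \<open>S\<close> gives the interlacing.\<close>

lemma interlace_of_zero_in_gaps:
  fixes P Q :: "real poly" and l r :: real
  defines "S \<equiv> {x. poly P x = 0}"
  assumes "rsquarefree P" "Q \<noteq> 0" "S \<subseteq> {l<..<r}" "l < r" "degree Q \<le> card S + 1"
    and gap: "\<And>x y. adjacent_in (insert l (insert r S)) x y \<Longrightarrow> \<exists>z. x < z \<and> z < y \<and> poly Q z = 0"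
  shows "card {x. poly Q x = 0} = card S + 1" "{x. poly Q x = 0} \<subseteq> {l<..<r}" "rsquarefree Q"
    "interlace P Q"
proof -
  define T where "T = insert l (insert r S)"
  \<comment> \<open>Each gap is indexed by its left endpoint, so \<open>r\<close> is left
    out.\<close>
  define A where "A = insert l S"
  define Z where "Z = {x. poly Q x = 0}"
  have "P \<noteq> 0" using assms(2) by (simp add: rsquarefree_def)
  then have fin: "finite S" unfolding S_def by (rule poly_roots_finite)
  have fZ: "finite Z" unfolding Z_def using \<open>Q \<noteq> 0\<close> by (rule poly_roots_finite)
  have S_bounds: "l < x" "x < r" if "x \<in> S" for x using that assms(4) by auto
  have "\<exists>y. adjacent_in T x y" if "x \<in> A" for x
  proof -
    define U where "U = {y \<in> T. x < y}"
    have "finite U" "r \<in> U" using fin that \<open>l < r\<close> S_bounds by (auto simp: U_def T_def A_def)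
    then have "Min U \<in> U" "\<And>z. z \<in> U \<Longrightarrow> Min U \<le> z" by (auto intro: Min_in)
    then have "adjacent_in T x (Min U)"
      using that by (fastforce simp: adjacent_in_def U_def T_def A_def)
    then show ?thesis ..
  qed
  then obtain nxt where nxt: "\<And>x. x \<in> A \<Longrightarrow> adjacent_in T x (nxt x)" by metis
  then have "\<forall>x\<in>A. \<exists>z. x < z \<and> z < nxt x \<and> poly Q z = 0"
    using gap unfolding T_def by blast
  then obtain \<zeta> where \<zeta>: "\<And>x. x \<in> A \<Longrightarrow> x < \<zeta> x" "\<And>x. x \<in> A \<Longrightarrow> \<zeta> x < nxt x"
    "\<And>x. x \<in> A \<Longrightarrow> poly Q (\<zeta> x) = 0" by metis
  have nxt_le: "nxt x \<le> y" if "x \<in> A" "y \<in> T" "x < y" for x y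
    using nxt[OF that(1)] that by (auto simp: adjacent_in_def not_less[symmetric])
  have AT: "A \<subseteq> T" by (auto simp: A_def T_def)
  \<comment> \<open>Together with \<open>x < \<zeta> x\<close>, this places each chosen zero between
    its index and every later point of \<open>T\<close>; the order arguments below rest on
    it.\<close>
  have mono: "\<zeta> x < y" if "x \<in> A" "y \<in> T" "x < y" for x y
    using nxt_le[OF that] \<zeta>(2)[OF that(1)] by simp
  have "l \<notin> S" using S_bounds by blast
  then have "card A = card S + 1" using fin by (simp add: A_def)
  moreover have "inj_on \<zeta> A"
    by (rule linorder_inj_onI') (metis \<zeta>(1) mono AT order.strict_trans subsetD less_irrefl)
  ultimately have cardim: "card (\<zeta> ` A) = card S + 1" by (simp add: card_image)
  have sub: "\<zeta> ` A \<subseteq> Z" using \<zeta>(3) by (auto simp: Z_def)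
  have le: "card Z \<le> degree Q" unfolding Z_def using \<open>Q \<noteq> 0\<close> by (rule card_poly_roots_bound)
  have Z: "Z = \<zeta> ` A"
    using card_seteq[OF fZ sub] le cardim assms(6) by simp
  show card: "card {x. poly Q x = 0} = card S + 1" using Z cardim by (simp add: Z_def)
  have inside: "l < \<zeta> x \<and> \<zeta> x < r" if "x \<in> A" for x
    using \<zeta>(1)[OF that] mono[OF that, of r] that \<open>l < r\<close> S_bounds
    by (force simp: A_def T_def)
  then show "{x. poly Q x = 0} \<subseteq> {l<..<r}" using Z by (auto simp: Z_def)
  show sqf: "rsquarefree Q"
    using \<open>Q \<noteq> 0\<close> card assms(6) by (intro rsquarefree_of_card_roots) auto
  have zero_cases: "\<exists>x\<in>A. z = \<zeta> x" if "poly Q z = 0" for z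
    using that Z by (auto simp: Z_def)
  have no_common: "\<not> (poly P z = 0 \<and> poly Q z = 0)" for z
  proof
    assume *: "poly P z = 0 \<and> poly Q z = 0"
    then obtain x where x: "x \<in> A" "z = \<zeta> x" using zero_cases by blast
    have "z \<in> T" using * by (simp add: T_def S_def)
    then show False using \<zeta>(1)[OF x(1)] mono[OF x(1), of z] x(2) by simp
  qed
  have gapP: "\<exists>!z. x < z \<and> z < y \<and> poly Q z = 0" if "consecutive_zeros P x y" for x y
  proof (rule ex1I[of _ "\<zeta> x"])
    have xy: "x \<in> S" "y \<in> S" "x < y" using that by (auto simp: consecutive_zeros_def S_def)
    then have xA: "x \<in> A" and yT: "y \<in> T" by (auto simp: A_def T_def)
    show "x < \<zeta> x \<and> \<zeta> x < y \<and> poly Q (\<zeta> x) = 0"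
      using \<zeta>(1,3)[OF xA] mono[OF xA yT xy(3)] by simp
    fix z assume z: "x < z \<and> z < y \<and> poly Q z = 0"
    then obtain u where u: "u \<in> A" "z = \<zeta> u" using zero_cases by blast
    \<comment> \<open>An index \<open>u < x\<close> would put \<open>z\<close> before
      \<open>x\<close>; an index \<open>u > x\<close> would be a zero of \<open>P\<close> between
      two consecutive ones.\<close>
    have "\<not> u < x" using mono[OF u(1), of x] AT xA z u by force
    moreover have "\<not> x < u"
    proof
      assume "x < u"
      then have "u \<in> S" using u(1) S_bounds[OF xy(1)] by (auto simp: A_def)
      moreover have "u < y" using \<zeta>(1)[OF u(1)] z u(2) by simp
      ultimately show False using that \<open>x < u\<close> by (auto simp: consecutive_zeros_def S_def)
    qed
    ultimately show "z = \<zeta> x" using u(2) by simp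
  qed
  have gapQ: "\<exists>!z. x < z \<and> z < y \<and> poly P z = 0" if "consecutive_zeros Q x y" for x y
  proof -
    have "poly Q x = 0" "poly Q y = 0" "x < y"
      and noQ: "\<And>z. x < z \<Longrightarrow> z < y \<Longrightarrow> poly Q z \<noteq> 0"
      using that by (auto simp: consecutive_zeros_def)
    then obtain u v where u: "u \<in> A" "x = \<zeta> u" and v: "v \<in> A" "y = \<zeta> v"
      using zero_cases by metis
    have "u < v"
    proof (rule ccontr)
      assume "\<not> u < v"
      then have "v < u \<or> v = u" by auto
      then have "y \<le> x"
        using mono[OF v(1), of u] \<zeta>(1)[OF u(1)] AT u v by force
      then show False using \<open>x < y\<close> by simp
    qed
    \<comment> \<open>Exceeding another index, \<open>v\<close> is not \<open>l\<close>. This zero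
      of \<open>P\<close> is the one separating \<open>\<zeta> u\<close> from
      \<open>\<zeta> v\<close>.\<close>
    have vS: "v \<in> S" using \<open>u < v\<close> u v S_bounds by (force simp: A_def)
    have xv: "x < v" using mono[OF u(1), of v] \<open>u < v\<close> AT u v by auto
    have vy: "v < y" using \<zeta>(1)[OF v(1)] v by simp
    show ?thesis
    proof (rule ex1I[of _ v])
      show "x < v \<and> v < y \<and> poly P v = 0" using xv vy vS by (simp add: S_def)
      fix w assume w: "x < w \<and> w < y \<and> poly P w = 0"
      then have wA: "w \<in> A" by (simp add: A_def S_def)
      then have wT: "w \<in> T" using AT by blast
      \<comment> \<open>If \<open>v < w\<close>, then \<open>y = \<zeta> v < w\<close>; if
        \<open>w < v\<close>, then \<open>\<zeta> w\<close> is a zero of \<open>Q\<close> between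
        \<open>x\<close> and \<open>y\<close>. Both are excluded.\<close>
      have "\<not> v < w" using mono[OF v(1) wT] w v by auto
      moreover have "\<not> w < v"
      proof
        assume "w < v"
        then have "\<zeta> w < v" using mono[OF wA, of v] v AT by auto
        then show False using noQ[of "\<zeta> w"] \<zeta>(1,3)[OF wA] w vy by auto
      qed
      ultimately show "w = v" by simp
    qed
  qed
  show "interlace P Q"
    unfolding interlace_def using assms(2) sqf no_common gapP gapQ by blast
qed

text \<open>The signs of \<open>Q\<close> at the two ends of a gap are compared with that of
  \<open>P\<close> at the midpoint \<open>m\<close>: opposite on the left, equal on the right. At a
  zero of \<open>P\<close> the comparison goes through the derivative, at \<open>l\<close> and
  \<open>r\<close> through the constant sign of \<open>P\<close> on the gap.\<close>

lemma sign_change_in_gaps: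
  fixes P Q :: "real poly" and l r :: real
  defines "S \<equiv> {x. poly P x = 0}"
  assumes "rsquarefree P" "S \<subseteq> {l<..<r}" "S \<noteq> {}"
    and opp: "\<And>x. x \<in> S \<Longrightarrow> poly Q x * poly (pderiv P) x < 0"
    and r: "poly P r * poly Q r > 0" and l: "poly P l * poly Q l < 0"
    and adj: "adjacent_in (insert l (insert r S)) x y"
  shows "\<exists>z. x < z \<and> z < y \<and> poly Q z = 0"
proof -
  have xy: "x < y" and nz: "\<And>z. x < z \<Longrightarrow> z < y \<Longrightarrow> poly P z \<noteq> 0"
    using adj by (auto simp: adjacent_in_def S_def)
  have S_bounds: "l < x" "x < r" if "x \<in> S" for x using that assms(3) by auto
  have lr: "l < r" using assms(4) S_bounds by force
  define m where "m = (x + y) / 2"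
  have m: "x < m" "m < y" using xy by (auto simp: m_def)
  have der: "poly (pderiv P) z \<noteq> 0" if "z \<in> S" for z using opp[OF that] by auto
  have "poly P l \<noteq> 0" "poly P r \<noteq> 0" using l r by auto
  have left: "poly P m * poly Q x < 0"
  proof (cases "x \<in> S")
    case True
    have "poly (pderiv P) x * poly P m > 0"
      using True der m nz by (intro sign_right_of_zero) (auto simp: S_def)
    with opp[OF True] show ?thesis by (auto simp: mult_less_0_iff zero_less_mult_iff)
  next
    case False
    then have "x = l" using adj S_bounds lr by (force simp: adjacent_in_def)
    then have "poly P x * poly P m > 0"
      using m nz \<open>poly P l \<noteq> 0\<close> by (intro poly_same_sign) (auto simp: le_less)
    with l show ?thesis using \<open>x = l\<close> by (auto simp: mult_less_0_iff zero_less_mult_iff)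
  qed
  have right: "poly P m * poly Q y > 0"
  proof (cases "y \<in> S")
    case True
    have "poly (pderiv P) y * poly P m < 0"
      using True der m nz by (intro sign_left_of_zero) (auto simp: S_def)
    with opp[OF True] show ?thesis by (auto simp: mult_less_0_iff zero_less_mult_iff)
  next
    case False
    then have "y = r" using adj S_bounds lr by (force simp: adjacent_in_def)
    then have "poly P m * poly P y > 0"
      using m nz \<open>poly P r \<noteq> 0\<close> by (intro poly_same_sign) (auto simp: le_less)
    with r show ?thesis using \<open>y = r\<close> by (auto simp: mult_less_0_iff zero_less_mult_iff)
  qed
  have "poly Q x * poly Q y < 0"
    using left right by (auto simp: mult_less_0_iff zero_less_mult_iff)
  from poly_IVT[OF xy this] show ?thesis by blast
qed

section \<open>The recurrence for \<open>R\<close>\<close>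

theorem proposition1:
  fixes a :: real and R :: "nat \<Rightarrow> real poly"
  assumes "a > 0"
    and "R 1 = [:0, 1:]"
    and "\<And>n. n \<ge> 1 \<Longrightarrow>
      R (n + 1) = [:0, 1:] * R n - smult (a / real n) ((1 - [:0, 1:] ^ 2) * pderiv (R n))"
  shows "(\<forall>n\<ge>1. card {x. poly (R n) x = 0} = n \<and> rsquarefree (R n) \<and>
                {x. poly (R n) x = 0} \<subseteq> {-1<..<1}) \<and>
         (\<forall>n\<ge>1. interlace (R n) (R (n + 1)))"
proof -
  have val: "poly (R (n + 1)) x = x * poly (R n) x - a / real n * (1 - x\<^sup>2) * poly (pderiv (R n)) x"
    if "n \<ge> 1" for n x
    using assms(3)[OF that] by simp
  \<comment> \<open>At \<open>1\<close> and \<open>-1\<close> the derivative term vanishes, so each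
    step only multiplies the value by \<open>1\<close> or \<open>-1\<close>.\<close>
  have one: "poly (R n) 1 = 1" if "n \<ge> 1" for n
    using that
  proof (induction n rule: dec_induct)
    case (step n)
    then show ?case using val[of n 1] by simp
  qed (simp add: assms(2)[simplified])
  have minus: "poly (R n) (-1) = (-1) ^ n" if "n \<ge> 1" for n
    using that
  proof (induction n rule: dec_induct)
    case (step n)
    then show ?case using val[of n "-1"] by simp
  qed (simp add: assms(2)[simplified])
  have deg: "degree (R n) \<le> n" if "n \<ge> 1" for n
    using that
  proof (induction n rule: dec_induct)
    case (step n)
    have "degree ([:0, 1:] * R n) \<le> Suc n"
      using step.IH by (intro order.trans[OF degree_mult_le]) simp
    moreover have "degree (1 - [:0, 1:] ^ 2 :: real poly) \<le> 2"
      by (simp add: power2_eq_square one_pCons)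
    \<comment> \<open>The degree of the derivative is a truncated difference; for a constant
      \<open>R n\<close> the bound becomes \<open>2 \<le> Suc n\<close>, which holds as
      \<open>n \<ge> 1\<close>.\<close>
    then have "degree ((1 - [:0, 1:] ^ 2) * pderiv (R n)) \<le> Suc n"
      using step by (intro order.trans[OF degree_mult_le]) (simp add: degree_pderiv)
    ultimately show ?case
      using assms(3)[of n] step
      by (auto intro!: degree_diff_le order.trans[OF degree_smult_le])
  qed (simp add: assms(2)[simplified])
  have nonzero: "R n \<noteq> 0" if "n \<ge> 1" for n using one[OF that] by auto
  \<comment> \<open>The induction invariant. Interlacing stays outside it, since each step derives
    it from \<open>G n\<close>.\<close>
  define G where "G n \<longleftrightarrow> card {x. poly (R n) x = 0} = n \<and> rsquarefree (R n) \<and>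
    {x. poly (R n) x = 0} \<subseteq> {-1<..<1}" for n
  have step: "G (n + 1) \<and> interlace (R n) (R (n + 1))" if "n \<ge> 1" "G n" for n
  proof -
    let ?S = "{x. poly (R n) x = 0}"
    have G: "card ?S = n" "rsquarefree (R n)" "?S \<subseteq> {-1<..<1}"
      using \<open>G n\<close> by (auto simp: G_def)
    have ne: "?S \<noteq> {}" using G(1) \<open>n \<ge> 1\<close> by (metis card.empty not_one_le_zero)
    have opp: "poly (R (n + 1)) x * poly (pderiv (R n)) x < 0" if x: "x \<in> ?S" for x
    proof -
      have "-1 < x" "x < 1" using G(3) x by auto
      then have "x\<^sup>2 < 1" by (simp add: abs_square_less_1)
      then have "0 < a / real n * (1 - x\<^sup>2)" using \<open>a > 0\<close> \<open>n \<ge> 1\<close> by simp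
      moreover have "poly (pderiv (R n)) x \<noteq> 0" using G(2) x by (auto simp: rsquarefree_roots)
      then have "0 < poly (pderiv (R n)) x * poly (pderiv (R n)) x"
        by (auto simp: zero_less_mult_iff)
      ultimately have "0 < a / real n * (1 - x\<^sup>2) * (poly (pderiv (R n)) x * poly (pderiv (R n)) x)"
        by (rule mult_pos_pos)
      then show ?thesis using val[OF \<open>n \<ge> 1\<close>, of x] x by (simp add: mult.assoc)
    qed
    have at_r: "poly (R n) 1 * poly (R (n + 1)) 1 > 0"
      using one \<open>n \<ge> 1\<close> by simp
    have at_l: "poly (R n) (-1) * poly (R (n + 1)) (-1) < 0"
      using minus[of n] minus[of "n + 1"] \<open>n \<ge> 1\<close> by (simp flip: power_mult_distrib)
    have Q: "R (n + 1) \<noteq> 0" "degree (R (n + 1)) \<le> card ?S + 1"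
      using nonzero[of "n + 1"] deg[of "n + 1"] G(1) by auto
    note zero_in_gap = sign_change_in_gaps[OF G(2,3) ne opp at_r at_l]
    note result = interlace_of_zero_in_gaps[OF G(2) Q(1) G(3) _ Q(2) zero_in_gap]
    show ?thesis unfolding G_def using result G(1) by simp
  qed
  have all: "G n" if "n \<ge> 1" for n
    using that
  proof (induction n rule: dec_induct)
    case base
    have "{x. poly (R 1) x = 0} = {0}" by (auto simp: assms(2)[simplified])
    moreover have "rsquarefree (R 1)" by (simp add: assms(2)[simplified] rsquarefree_roots pderiv_pCons)
    ultimately show ?case by (simp add: G_def)
  qed (use step in simp)
  then show ?thesis using step by (simp add: G_def)
qed

end
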